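(* Let $\mathcal{H}^n$ be an $n$-dimensional real or complex Hilbert space, let $\Phi=\{\varphi_i\}_{i=1}^N$ be a tight frame for $\mathcal{H}^n$ with frame operator $S_\Phi$, and let $\Psi=S_\Phi^{-1}\Phi=\{S_\Phi^{-1}\varphi_i\}_{i=1}^N$ be its canonical dual frame. Then, for each $x\in\mathcal{H}^n$ with $\|x\|=1$, $$\mathcal{R}_\Phi(x)=\mathcal{R}_\Psi(x).$$
   Context: The frame operator of a frame $\Phi=\{\varphi_i\}_{i=1}^N$ is $S_\Phi x=\sum_{i=1}^N\langle x,\varphi_i\rangle\varphi_i$; a frame is tight if its lower and upper frame bounds can be chosen equal. The redundancy function of $\Phi$ is defined for unit vectors $x$ by $\mathcal{R}_\Phi(x)=\sum_{i=1}^N\|P_{\langle\varphi_i\rangle}(x)\|^2$, where $P_{\langle\varphi_i\rangle}$ is the orthogonal projection onto $\langle\varphi_i\rangle=\operatorname{span}\{\varphi_i\}$. *)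

theory Defs
  imports Complex_Main
begin

text \<open>
  By Ostrowski's and Mazur's theorem every \<open>real_normed_field\<close> is isometrically isomorphic to
  the reals or the complex numbers, and the first axiom below then leaves only the usual
  conjugation. So quantifying over this class means exactly ``real or complex scalars''.
\<close>

class real_or_complex = real_normed_field +
  fixes conjugate :: "'a \<Rightarrow> 'a"
  assumes mult_conjugate: "x * conjugate x = (norm x)\<^sup>2 *\<^sub>R 1"
    and conjugate_add: "conjugate (x + y) = conjugate x + conjugate y"

instantiation real :: real_or_complex
begin
definition conjugate_real :: "real \<Rightarrow> real" where "conjugate_real x = x"
instance by standard (simp_all add: conjugate_real_def power2_eq_square)
end

instantiation complex :: real_or_complex
begin
definition conjugate_complex :: "complex \<Rightarrow> complex" where "conjugate_complex = cnj"
instance by standard (simp_all add: conjugate_complex_def scaleR_conv_of_real flip: complex_norm_square)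
end

text \<open>
  The inner product is linear in its first argument. The axiom \<open>ip_self\<close> says that
  \<open>\<langle>x, x\<rangle>\<close> is a nonnegative real number.
\<close>

locale inner_product_space = vector_space scale
  for scale :: "'k::real_or_complex \<Rightarrow> 'v::ab_group_add \<Rightarrow> 'v" (infixr \<open>*s\<close> 75) +
  fixes ip :: "'v \<Rightarrow> 'v \<Rightarrow> 'k"
  assumes ip_add_left: "ip (x + y) z = ip x z + ip y z"
    and ip_scale_left: "ip (a *s x) y = a * ip x y"
    and ip_commute: "ip y x = conjugate (ip x y)"
    and ip_self: "ip x x = of_real (norm (ip x x))"
    and ip_definite: "ip x x = 0 \<Longrightarrow> x = 0"
begin

definition vnorm :: "'v \<Rightarrow> real" where
  "vnorm x = sqrt (norm (ip x x))"

definition orth_proj :: "'v set \<Rightarrow> 'v \<Rightarrow> 'v" where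
  "orth_proj W x = (THE p. p \<in> W \<and> (\<forall>w\<in>W. ip (x - p) w = 0))"

text \<open>
  A family \<open>\<phi>\<^sub>1, \<dots>, \<phi>\<^sub>N\<close> is a function on \<^typ>\<open>nat\<close> of which only the values on \<open>{1..N}\<close>
  matter.
\<close>

definition frame_bounds :: "nat \<Rightarrow> (nat \<Rightarrow> 'v) \<Rightarrow> real \<Rightarrow> real \<Rightarrow> bool" where
  "frame_bounds N \<phi> A B \<longleftrightarrow> 0 < A \<and> A \<le> B \<and>
     (\<forall>x. A * (vnorm x)\<^sup>2 \<le> (\<Sum>i=1..N. (norm (ip x (\<phi> i)))\<^sup>2) \<and>
          (\<Sum>i=1..N. (norm (ip x (\<phi> i)))\<^sup>2) \<le> B * (vnorm x)\<^sup>2)"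

definition tight_frame :: "nat \<Rightarrow> (nat \<Rightarrow> 'v) \<Rightarrow> bool" where
  "tight_frame N \<phi> \<longleftrightarrow> (\<exists>A. frame_bounds N \<phi> A A)"

definition frame_operator :: "nat \<Rightarrow> (nat \<Rightarrow> 'v) \<Rightarrow> 'v \<Rightarrow> 'v" where
  "frame_operator N \<phi> x = (\<Sum>i=1..N. ip x (\<phi> i) *s \<phi> i)"

definition canonical_dual :: "nat \<Rightarrow> (nat \<Rightarrow> 'v) \<Rightarrow> nat \<Rightarrow> 'v" where
  "canonical_dual N \<phi> i = inv (frame_operator N \<phi>) (\<phi> i)"

text \<open>A zero vector \<open>\<phi>\<^sub>i\<close> is allowed and contributes 0, its span being \<open>{0}\<close>.\<close>

definition redundancy :: "nat \<Rightarrow> (nat \<Rightarrow> 'v) \<Rightarrow> 'v \<Rightarrow> real" where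
  "redundancy N \<phi> x = (\<Sum>i=1..N. (vnorm (orth_proj (span {\<phi> i}) x))\<^sup>2)"

end

text \<open>Completeness is automatic in finite dimension.\<close>

locale fin_dim_hilbert_space = inner_product_space scale ip
  for scale :: "'k::real_or_complex \<Rightarrow> 'v::ab_group_add \<Rightarrow> 'v" (infixr \<open>*s\<close> 75)
    and ip :: "'v \<Rightarrow> 'v \<Rightarrow> 'k" +
  fixes n :: nat
  assumes dimension: "\<exists>B. finite B \<and> card B = n \<and> independent B \<and> span B = UNIV"

end

theory Submission imports Defs begin

text \<open>
  For a tight frame with bound \<open>A\<close> the operator \<open>S - A I\<close> is self-adjoint with vanishing quadratic
  form, hence zero. So \<open>\<psi>\<^sub>i = A\<^sup>-\<^sup>1 \<phi>\<^sub>i\<close> spans the same line as \<open>\<phi>\<^sub>i\<close>, and the redundancy depends on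
  these lines only.
\<close>

lemma conjugate_0 [simp]: "conjugate (0::'k::real_or_complex) = 0"
  using conjugate_add[of "0::'k" 0] by simp

text \<open>Away from 0 the axiom \<open>mult_conjugate\<close> can be solved for the conjugate.
  Multiplicativity and the fixing of real scalars are then inherited from the norm; the argument 0
  is settled by additivity.\<close>

lemma conjugate_eq_divide:
  fixes a :: "'k::real_or_complex"
  assumes "a \<noteq> 0"
  shows "conjugate a = of_real ((norm a)\<^sup>2) / a"
  using mult_conjugate[of a] assms by (simp add: field_simps scaleR_conv_of_real)

lemma conjugate_mult: "conjugate (a * b) = conjugate a * conjugate (b::'k::real_or_complex)"
  by (cases "a = 0 \<or> b = 0") (auto simp: conjugate_eq_divide norm_mult power_mult_distrib)

lemma conjugate_of_real [simp]: "conjugate (of_real r) = (of_real r :: 'k::real_or_complex)"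
proof (cases "r = 0")
  case False
  then show ?thesis
    by (simp add: conjugate_eq_divide of_real_divide[symmetric] power2_eq_square del: of_real_divide)
qed simp

lemma conjugate_sum:
  "conjugate (\<Sum>i\<in>I. f i) = (\<Sum>i\<in>I. conjugate (f i :: 'k::real_or_complex))"
  by (induction I rule: infinite_finite_induct) (simp_all add: conjugate_add)

context inner_product_space
begin

lemma ip_add_right: "ip z (x + y) = ip z x + ip z y"
  by (metis conjugate_add ip_add_left ip_commute)

lemma ip_scale_right: "ip x (a *s y) = conjugate a * ip x y"
  by (metis conjugate_mult ip_commute ip_scale_left)

lemma ip_zero_left [simp]: "ip 0 y = 0"
  using ip_add_left[of 0 0 y] by simp

lemma ip_diff_left: "ip (x - y) z = ip x z - ip y z"
  using ip_add_left[of "x - y" y z] by simp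

lemma ip_diff_right: "ip z (x - y) = ip z x - ip z y"
  using ip_add_right[of z "x - y" y] by simp

lemma ip_sum_left: "ip (\<Sum>i\<in>I. f i) y = (\<Sum>i\<in>I. ip (f i) y)"
  by (induction I rule: infinite_finite_induct) (simp_all add: ip_add_left)

text \<open>Turns each summand of the quadratic form of the frame operator into a squared
  coefficient as in \<open>frame_bounds\<close>.\<close>

lemma mult_ip_commute: "ip x y * ip y x = of_real ((norm (ip x y))\<^sup>2)"
  using mult_conjugate[of "ip x y"] ip_commute[of y x] by (simp add: scaleR_conv_of_real)

lemma of_real_vnorm_power2: "of_real ((vnorm x)\<^sup>2) = ip x x"
  using ip_self[of x] by (simp add: vnorm_def)

lemma ip_frame_operator_left:
  "ip (frame_operator N \<phi> x) y = (\<Sum>i=1..N. ip x (\<phi> i) * ip (\<phi> i) y)"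
  by (simp add: frame_operator_def ip_sum_left ip_scale_left)

lemma frame_operator_self_adjoint:
  "ip (frame_operator N \<phi> x) y = ip x (frame_operator N \<phi> y)"
proof -
  have "ip x (frame_operator N \<phi> y) = conjugate (\<Sum>i=1..N. ip y (\<phi> i) * ip (\<phi> i) x)"
    by (metis ip_commute ip_frame_operator_left)
  \<comment> \<open>Conjugation reverses both inner products in a summand, which only swaps the
    roles of its two factors.\<close>
  also have "\<dots> = (\<Sum>i=1..N. ip x (\<phi> i) * ip (\<phi> i) y)"
    by (simp add: conjugate_sum conjugate_mult mult.commute flip: ip_commute)
  finally show ?thesis by (simp add: ip_frame_operator_left)
qed

text \<open>Polarisation in the direction \<open>T x\<close>, uniform for both scalar fields. Over
  the reals self-adjointness is essential: a quarter turn of the plane has vanishing form.\<close>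

lemma self_adjoint_eq_0:
  assumes add: "\<And>x y. T (x + y) = T x + T y"
    and self_adjoint: "\<And>x y. ip (T x) y = ip x (T y)"
    and form: "\<And>x. ip (T x) x = 0"
  shows "T x = 0"
proof -
  \<comment> \<open>On expansion the two diagonal terms vanish, and self-adjointness makes the two
    cross terms equal.\<close>
  have "0 = ip (T (x + T x)) (x + T x)"
    by (simp add: form)
  also have "\<dots> = ip (T x) (T x) + ip (T (T x)) x"
    by (simp add: add ip_add_left ip_add_right form)
  also have "\<dots> = 2 * ip (T x) (T x)"
    using self_adjoint[of "T x" x] by simp
  finally have "ip (T x) (T x) = 0" by simp
  then show ?thesis by (rule ip_definite)
qed

lemma frame_operator_add: "frame_operator N \<phi> (x + y) = frame_operator N \<phi> x + frame_operator N \<phi> y"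
  by (simp add: frame_operator_def ip_add_left scale_left_distrib sum.distrib)

lemma frame_operator_tight:
  assumes "frame_bounds N \<phi> A A"
  shows "frame_operator N \<phi> x = of_real A *s x"
proof -
  define T where "T = (\<lambda>x. frame_operator N \<phi> x - of_real A *s x)"
  have parseval: "(\<Sum>i=1..N. (norm (ip x (\<phi> i)))\<^sup>2) = A * (vnorm x)\<^sup>2" for x
    using assms by (auto simp: frame_bounds_def intro: antisym)
  have form: "ip (T x) x = 0" for x
  proof -
    have "ip (frame_operator N \<phi> x) x = of_real (\<Sum>i=1..N. (norm (ip x (\<phi> i)))\<^sup>2)"
      unfolding ip_frame_operator_left mult_ip_commute by (simp only: of_real_sum)
    also have "\<dots> = of_real A * ip x x"
      by (simp only: parseval of_real_mult of_real_vnorm_power2)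
    finally show ?thesis
      by (simp add: T_def ip_diff_left ip_scale_left)
  qed
  \<comment> \<open>Subtracting \<open>of_real A\<close> times the identity keeps self-adjointness
    because conjugation fixes real scalars.\<close>
  have "T x = 0"
    by (rule self_adjoint_eq_0[OF _ _ form])
      (simp_all add: T_def frame_operator_add scale_right_distrib ip_diff_left ip_diff_right
        ip_scale_left ip_scale_right frame_operator_self_adjoint)
  then show ?thesis by (simp add: T_def)
qed

lemma canonical_dual_tight:
  assumes "frame_bounds N \<phi> A A"
  shows "canonical_dual N \<phi> i = of_real (inverse A) *s \<phi> i"
proof -
  have "A \<noteq> 0" using assms by (simp add: frame_bounds_def)
  moreover have "frame_operator N \<phi> = (\<lambda>x. of_real A *s x)"
    using frame_operator_tight[OF assms] by blast
  \<comment> \<open>\<open>inv\<close> picks an arbitrary preimage, so injectivity is needed to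
    identify it with the rescaled vector; it comes from A being nonzero.\<close>
  ultimately show ?thesis
    unfolding canonical_dual_def by (auto intro!: inv_f_eq injI)
qed

lemma span_singleton_scale:
  assumes "c \<noteq> 0"
  shows "span {c *s v} = span {v}"
proof
  show "span {c *s v} \<subseteq> span {v}"
    by (simp add: span_minimal span_base span_scale)
  have "v = inverse c *s c *s v" using assms by simp
  then have "v \<in> span {c *s v}"
    by (metis span_base span_scale singletonI)
  then show "span {v} \<subseteq> span {c *s v}"
    by (simp add: span_minimal)
qed

text \<open>The vectors enter \<open>redundancy\<close> only through their spans, which a nonzero
  scalar leaves unchanged, so the two sums agree term by term.\<close>

lemma redundancy_canonical_dual_tight:
  assumes "tight_frame N \<phi>"
  shows "redundancy N (canonical_dual N \<phi>) x = redundancy N \<phi> x"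
proof -
  obtain A where A: "frame_bounds N \<phi> A A"
    using assms by (auto simp: tight_frame_def)
  then have "A \<noteq> 0" by (simp add: frame_bounds_def)
  then have "span {canonical_dual N \<phi> i} = span {\<phi> i}" for i
    by (simp only: canonical_dual_tight[OF A]) (simp add: span_singleton_scale)
  then show ?thesis by (simp add: redundancy_def)
qed

end

theorem proposition4p5:
  fixes scale :: "'k::real_or_complex \<Rightarrow> 'v::ab_group_add \<Rightarrow> 'v"
    and ip :: "'v \<Rightarrow> 'v \<Rightarrow> 'k"
    and n N :: nat
    and \<phi> \<psi> :: "nat \<Rightarrow> 'v"
    and x :: 'v
  assumes "fin_dim_hilbert_space scale ip n"
    and "inner_product_space.tight_frame ip N \<phi>"
    and "\<psi> = inner_product_space.canonical_dual scale ip N \<phi>"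
    and "inner_product_space.vnorm ip x = 1"
  shows "inner_product_space.redundancy scale ip N \<phi> x
       = inner_product_space.redundancy scale ip N \<psi> x"
proof -
  interpret fin_dim_hilbert_space scale ip n by fact
  show ?thesis
    using assms(2) by (simp add: assms(3) redundancy_canonical_dual_tight)
qed

end
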